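(* Let $r\ge 0$, $t\ge 0$ and $\ell\ge 1$ be integers. If a graph $G$ is an $r$-shallow minor of $H\boxtimes P\boxtimes K_\ell$, where $H$ is a graph of treewidth at most $t$ and $P$ is a path, then $G$ is contained in $J\boxtimes P\boxtimes K_{\ell(2r+1)^2}$ for some graph $J$ with treewidth at most $\binom{2r+1+t}{t}-1$, and thus the row treewidth of $G$ satisfies $\mathrm{rtw}(G)\le \binom{2r+1+t}{t}\ell(2r+1)^2-1$.
   Context: All graphs are finite, simple and undirected. A graph $G$ is contained in $G'$ if $G$ is isomorphic to a subgraph of $G'$. The strong product $G_1\boxtimes G_2$ has vertex set $V(G_1)\times V(G_2)$, with distinct $(a,v),(b,u)$ adjacent iff ($ab\in E(G_1)$ and $u=v$) or ($a=b$ and $uv\in E(G_2)$) or ($ab\in E(G_1)$ and $uv\in E(G_2)$). $K_\ell$ is the complete graph on $\ell$ vertices. A model of $G$ in $G'$ assigns to each $v\in V(G)$ a connected subgraph $\mu(v)$ of $G'$, pairwise vertex-disjoint, such that for every edge $vw\in E(G)$ some edge of $G'$ joins $\mu(v)$ and $\mu(w)$; $G$ is an $r$-shallow minor of $G'$ if there is a model with every $\mu(v)$ of radius at most $r$. The row treewidth $\mathrm{rtw}(G)$ is the minimum treewidth of a graph $H'$ such that $G$ is contained in $H'\boxtimes P'$ for some path $P'$. *)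

theory Defs
  imports Main "HOL-Library.Disjoint_Sets"
begin

text \<open>A (finite, simple, undirected) graph is a pair (V, E) of a vertex set and a set
  of edges, each edge being a two-element subset of V.\<close>

type_synonym 'a graph = "'a set \<times> 'a set set"

abbreviation verts :: "'a graph \<Rightarrow> 'a set" where "verts G \<equiv> fst G"
abbreviation edges :: "'a graph \<Rightarrow> 'a set set" where "edges G \<equiv> snd G"

definition graph :: "'a graph \<Rightarrow> bool" where
  "graph G \<longleftrightarrow> finite (verts G) \<and>
     (\<forall>e\<in>edges G. \<exists>u v. e = {u, v} \<and> u \<noteq> v \<and> u \<in> verts G \<and> v \<in> verts G)"

text \<open>Adjacency relation of G restricted to a vertex set S (edges of the induced subgraph G[S]).\<close>
definition adj_in :: "'a graph \<Rightarrow> 'a set \<Rightarrow> ('a \<times> 'a) set" where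
  "adj_in G S = {(u, v). u \<in> S \<and> v \<in> S \<and> {u, v} \<in> edges G}"

text \<open>G[S] is connected (and nonempty).\<close>
definition connected_in :: "'a graph \<Rightarrow> 'a set \<Rightarrow> bool" where
  "connected_in G S \<longleftrightarrow> S \<noteq> {} \<and> (\<forall>u\<in>S. \<forall>v\<in>S. (u, v) \<in> (adj_in G S)\<^sup>*)"

text \<open>G[S] has radius at most r: some centre reaches every vertex of S by a path in G[S]
  of length at most r.\<close>
definition radius_le :: "'a graph \<Rightarrow> 'a set \<Rightarrow> nat \<Rightarrow> bool" where
  "radius_le G S r \<longleftrightarrow> (\<exists>c\<in>S. \<forall>x\<in>S. \<exists>k\<le>r. (c, x) \<in> (adj_in G S) ^^ k)"

text \<open>Strong product.\<close>
definition strong_prod :: "'a graph \<Rightarrow> 'b graph \<Rightarrow> ('a \<times> 'b) graph" (infixl "\<boxtimes>" 70) where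
  "G1 \<boxtimes> G2 = (verts G1 \<times> verts G2,
     {{(a, v), (b, u)} | a v b u. a \<in> verts G1 \<and> b \<in> verts G1 \<and> v \<in> verts G2 \<and> u \<in> verts G2 \<and>
        (a, v) \<noteq> (b, u) \<and>
        (({a, b} \<in> edges G1 \<and> u = v) \<or> (a = b \<and> {u, v} \<in> edges G2) \<or>
         ({a, b} \<in> edges G1 \<and> {u, v} \<in> edges G2))})"

text \<open>Complete graph on \<ell> vertices.\<close>
definition complete :: "nat \<Rightarrow> nat graph" ("K") where
  "K l = ({0..<l}, {{i, j} | i j. i < l \<and> j < l \<and> i \<noteq> j})"

text \<open>P is a path graph (with at least one vertex).\<close>
definition is_path :: "'a graph \<Rightarrow> bool" where
  "is_path P \<longleftrightarrow> (\<exists>xs. xs \<noteq> [] \<and> distinct xs \<and> set xs = verts P \<and>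
      edges P = {{xs ! i, xs ! (i + 1)} | i. i + 1 < length xs})"

text \<open>G is contained in G': G is isomorphic to a subgraph of G'.\<close>
definition contained :: "'a graph \<Rightarrow> 'b graph \<Rightarrow> bool" where
  "contained G G' \<longleftrightarrow> (\<exists>f. inj_on f (verts G) \<and> f ` verts G \<subseteq> verts G' \<and>
      (\<forall>u v. {u, v} \<in> edges G \<longrightarrow> {f u, f v} \<in> edges G'))"

text \<open>Trees: connected graphs with |E| = |V| - 1.\<close>
definition is_tree :: "'a graph \<Rightarrow> bool" where
  "is_tree T \<longleftrightarrow> graph T \<and> connected_in T (verts T) \<and> card (edges T) + 1 = card (verts T)"

text \<open>Tree decomposition of G of width at most k, indexed by a tree T with bags B.\<close>
definition tree_decomp_width_le :: "'a graph \<Rightarrow> nat graph \<Rightarrow> (nat \<Rightarrow> 'a set) \<Rightarrow> nat \<Rightarrow> bool" where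
  "tree_decomp_width_le G T B k \<longleftrightarrow> is_tree T \<and>
     (\<forall>x\<in>verts T. B x \<subseteq> verts G \<and> card (B x) \<le> k + 1) \<and>
     (\<forall>v\<in>verts G. \<exists>x\<in>verts T. v \<in> B x) \<and>
     (\<forall>u v. {u, v} \<in> edges G \<longrightarrow> (\<exists>x\<in>verts T. u \<in> B x \<and> v \<in> B x)) \<and>
     (\<forall>v\<in>verts G. connected_in T {x\<in>verts T. v \<in> B x})"

definition treewidth :: "'a graph \<Rightarrow> nat" where
  "treewidth G = (LEAST k. \<exists>T B. tree_decomp_width_le G T B k)"

text \<open>Models and r-shallow minors.\<close>
definition is_model :: "'a graph \<Rightarrow> 'b graph \<Rightarrow> ('a \<Rightarrow> 'b set) \<Rightarrow> bool" where
  "is_model G G' \<mu> \<longleftrightarrow>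
     (\<forall>v\<in>verts G. \<mu> v \<subseteq> verts G' \<and> connected_in G' (\<mu> v)) \<and>
     (\<forall>v\<in>verts G. \<forall>w\<in>verts G. v \<noteq> w \<longrightarrow> \<mu> v \<inter> \<mu> w = {}) \<and>
     (\<forall>v w. {v, w} \<in> edges G \<longrightarrow> (\<exists>x\<in>\<mu> v. \<exists>y\<in>\<mu> w. {x, y} \<in> edges G'))"

definition shallow_minor :: "nat \<Rightarrow> 'a graph \<Rightarrow> 'b graph \<Rightarrow> bool" where
  "shallow_minor r G G' \<longleftrightarrow> (\<exists>\<mu>. is_model G G' \<mu> \<and> (\<forall>v\<in>verts G. radius_le G' (\<mu> v) r))"

text \<open>Row treewidth (H' and P' range over graphs on nat, which is no loss since graphs are finite).\<close>
definition row_treewidth :: "'a graph \<Rightarrow> nat" where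
  "row_treewidth G = (LEAST k. \<exists>(H' :: nat graph) (P' :: nat graph).
      graph H' \<and> is_path P' \<and> graph P' \<and> treewidth H' = k \<and> contained G (H' \<boxtimes> P'))"

end

theory Submission
  imports Defs
begin

text \<open>Root a tree decomposition of H and order the vertices of H by the depth of their topmost node:
  in the resulting chordal completion the earlier neighbours of every vertex form a clique of size at
  most t. The vertices reached from z by decreasing walks of length at most \<open>2r+1\<close> then number at most
  \<open>(2r+1+t) choose t\<close>, and these sets are the bags of a tree decomposition, in which the parent of
  z is its latest earlier neighbour; J joins the vertices that share a bag. Send a vertex v of G to the
  earliest vertex \<open>h v\<close> of H met by its branch set. If v and w are adjacent and \<open>h v \<le> h w\<close>, then both
  lie in the bag of any vertex of the branch set of w that is adjacent to the branch set of v: a walk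
  that stays within a branch set up to its last step and ends in its least vertex can be shortcut to a
  decreasing one. The rows are cut into blocks of \<open>2r+1\<close>, so that adjacent vertices land in equal or
  consecutive blocks.\<close>

section \<open>Elimination orders and reachability\<close>

text \<open>\<open>N v\<close> stands for the earlier neighbours of v in a chordal graph on the
  naturals. The second conjunct is the perfect elimination property: these neighbours are pairwise
  adjacent, each such edge being recorded at its later end.\<close>

definition elim_order :: "(nat \<Rightarrow> nat set) \<Rightarrow> bool" where
  "elim_order N \<longleftrightarrow> (\<forall>v. \<forall>u\<in>N v. u < v) \<and> (\<forall>v. \<forall>u\<in>N v. \<forall>w\<in>N v. u < w \<longrightarrow> u \<in> N w)"

text \<open>Only descending walks are followed. In an elimination order they suffice to find every u
  that is joined to v by a walk of length at most s staying at or above u; \<open>reach_step\<close>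
  is the reason.\<close>

primrec reach :: "(nat \<Rightarrow> nat set) \<Rightarrow> nat \<Rightarrow> nat \<Rightarrow> nat set" where
  "reach N 0 v = {v}"
| "reach N (Suc s) v = insert v (\<Union>w\<in>N v. reach N s w)"

lemma elim_orderD:
  assumes "elim_order N"
  shows "u \<in> N v \<Longrightarrow> u < v"
    and "u \<in> N v \<Longrightarrow> w \<in> N v \<Longrightarrow> u < w \<Longrightarrow> u \<in> N w"
  using assms unfolding elim_order_def by blast+

lemma finite_elim_order: "elim_order N \<Longrightarrow> finite (N v)"
  by (rule finite_subset[of _ "{..<v}"]) (auto dest: elim_orderD(1))

lemma reach_self [simp]: "v \<in> reach N s v"
  by (cases s) auto

lemma reach_Suc_mono: "u \<in> reach N s v \<Longrightarrow> u \<in> reach N (Suc s) v"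
proof (induction s arbitrary: v)
  case 0
  then show ?case by simp
next
  case (Suc s)
  show ?case
  proof (cases "u = v")
    case False
    with Suc.prems obtain w where w: "w \<in> N v" "u \<in> reach N s w" by auto
    have "u \<in> reach N (Suc s) w" using Suc.IH[OF w(2)] .
    then have "u \<in> (\<Union>w\<in>N v. reach N (Suc s) w)" using w(1) by blast
    then show ?thesis by (subst reach.simps(2)) (rule insertI2)
  qed simp
qed

lemma reach_mono: "u \<in> reach N s v \<Longrightarrow> s \<le> s' \<Longrightarrow> u \<in> reach N s' v"
  by (rotate_tac 1, induction s' rule: dec_induct) (auto dest: reach_Suc_mono simp del: reach.simps)

lemma reach_le:
  assumes "elim_order N" "u \<in> reach N s v"
  shows "u \<le> v"
  using assms(2)
proof (induction s arbitrary: v)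
  case (Suc s)
  then show ?case using elim_orderD(1)[OF assms(1)] by fastforce
qed simp

lemma reach_pos:
  assumes "\<And>v. N v \<subseteq> {1..}" "u \<in> reach N s v" "v \<ge> 1"
  shows "u \<ge> 1"
  using assms(2,3)
proof (induction s arbitrary: v)
  case (Suc s)
  then show ?case using assms(1) by fastforce
qed simp

lemma finite_reach: "elim_order N \<Longrightarrow> finite (reach N s v)"
  by (rule finite_subset[of _ "{..v}"]) (auto dest: reach_le)

text \<open>Compare y with the first step z of the descending walk from x to u. Both are earlier
  neighbours of x, so unless they coincide they are adjacent: if z is the smaller, y steps to z in
  place of x; if y is the smaller, the argument repeats with z in the role of x.\<close>

lemma reach_via_neighbour:
  assumes "elim_order N" "u \<in> reach N s x" "y \<in> N x" "u \<le> y"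
  shows "u \<in> reach N s y"
  using assms(2-4)
proof (induction s arbitrary: x)
  case 0
  then show ?case using elim_orderD(1)[OF assms(1)] by force
next
  case (Suc s)
  have "u \<noteq> x" using Suc.prems elim_orderD(1)[OF assms(1)] by force
  with Suc.prems obtain z where z: "z \<in> N x" "u \<in> reach N s z" by auto
  consider "z = y" | "z < y" | "y < z" by linarith
  then show ?case
  proof cases
    case 1
    then show ?thesis using z reach_Suc_mono by blast
  next
    case 2
    then have "z \<in> N y" using elim_orderD(2)[OF assms(1)] z Suc.prems by blast
    then show ?thesis using z by auto
  next
    case 3
    then have "y \<in> N z" using elim_orderD(2)[OF assms(1)] z Suc.prems by blast
    then show ?thesis using Suc.IH[OF z(2)] Suc.prems reach_Suc_mono by blast
  qed
qed

text \<open>This is what shortcuts arbitrary walks to descending ones. Moving the start up along an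
  edge costs one step, and moving it down costs none by \<open>reach_via_neighbour\<close>.\<close>

lemma reach_step:
  assumes "elim_order N" "u \<in> reach N s x" "x = y \<or> x \<in> N y \<or> y \<in> N x" "u \<le> y"
  shows "u \<in> reach N (Suc s) y"
proof -
  consider "x = y" | "x \<in> N y" | "y \<in> N x" using assms(3) by blast
  then show ?thesis
  proof cases
    case 1
    then show ?thesis using assms reach_Suc_mono by blast
  next
    case 2
    then show ?thesis using assms by auto
  next
    case 3
    then show ?thesis using reach_via_neighbour[OF assms(1,2) _ assms(4)] reach_Suc_mono by blast
  qed
qed

text \<open>Let u be the least neighbour of v. Every vertex above u that v can reach has u among its
  neighbours, so above u only \<open>t - 1\<close> neighbours are left, while anything below u that is reached
  within s steps is reached from u within \<open>s - 1\<close> steps. This is Pascal's recursion.\<close>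
lemma card_reach_le:
  assumes "elim_order N" "\<And>v. card (N v) \<le> t"
  shows "card (reach N s v) \<le> (s + t) choose t"
  using assms
\<comment> \<open>One branch of the recursion lowers t and changes N, the other lowers s; hence
  induction on the sum with N general.\<close>
proof (induction "s + t" arbitrary: s t N v)
  case 0
  then show ?case by simp
next
  case (Suc n)
  note eo = Suc.prems(1)
  have fin: "finite (N v)" by (rule finite_elim_order[OF eo])
  show ?case
  proof (cases "s = 0 \<or> N v = {}")
    case True
    then have "reach N s v = {v}" by (cases s) auto
    then show ?thesis using zero_less_binomial[of t "s + t"] by (simp add: Suc_le_eq)
  next
    case False
    then obtain s' where s: "s = Suc s'" by (cases s) auto
    have "t \<noteq> 0" using False Suc.prems(2)[of v] fin by auto
    then obtain t' where t: "t = Suc t'" by (cases t) auto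
    define u where "u = Min (N v)"
    have uN: "u \<in> N v" and umin: "\<And>y. y \<in> N v \<Longrightarrow> u \<le> y"
      using False fin by (auto simp: u_def)
    \<comment> \<open>Vertices not having u among their earlier neighbours get no neighbours at all.
      All others lose u itself, which is what lowers the bound from t to t'.\<close>
    define M where "M = (\<lambda>x. if u \<in> N x then N x \<inter> {u<..} else {})"
    have M_iff: "y \<in> M x \<longleftrightarrow> u \<in> N x \<and> y \<in> N x \<and> u < y" for x y by (auto simp: M_def)
    have M: "elim_order M"
      unfolding elim_order_def Ball_def M_iff using elim_orderD[OF eo] by blast
    have cM: "card (M x) \<le> t'" for x
    proof (cases "u \<in> N x")
      case True
      have "M x \<subseteq> N x - {u}" by (auto simp: M_def)
      then have "card (M x) \<le> card (N x - {u})"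
        using finite_elim_order[OF eo] by (intro card_mono) auto
      also have "\<dots> \<le> t'" using True Suc.prems(2)[of x] t finite_elim_order[OF eo] by simp
      finally show ?thesis .
    qed (simp add: M_def)
    \<comment> \<open>A descending walk starting at a vertex adjacent to u keeps u as an earlier
      neighbour while it stays above u, so it runs in M. Once it steps to u or below, the vertex it
      enters is u or an earlier neighbour of u, and u can replace the vertex just left.\<close>
    have split: "w \<in> reach M k x \<or> w \<in> reach N k u" if "u \<in> N x" "w \<in> reach N k x" for w k x
      using that
    proof (induction k arbitrary: x)
      case (Suc k)
      show ?case
      proof (cases "w = x")
        case False
        with Suc.prems obtain y where y: "y \<in> N x" "w \<in> reach N k y" by auto
        consider "y = u" | "y < u" | "u < y" by linarith
        then show ?thesis
        proof cases
          case 1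
          then show ?thesis using y reach_Suc_mono by blast
        next
          case 2
          then have "y \<in> N u" using elim_orderD(2)[OF eo] y Suc.prems by blast
          then show ?thesis using y by auto
        next
          case 3
          then have "u \<in> N y" using elim_orderD(2)[OF eo] y Suc.prems by blast
          moreover have "y \<in> M x" using 3 y Suc.prems by (simp add: M_def)
          ultimately show ?thesis using Suc.IH[OF _ y(2)] reach_Suc_mono[of w N k u] by auto
        qed
      qed simp
    qed simp
    \<comment> \<open>\<open>split\<close> is applied after the first step of the walk, hence only
      s' steps are charged to u.\<close>
    have "reach N s v \<subseteq> reach M s v \<union> reach N s' u"
    proof
      fix w assume w: "w \<in> reach N s v"
      show "w \<in> reach M s v \<union> reach N s' u"
      proof (cases "w = v")
        case False
        with w s obtain y where y: "y \<in> N v" "w \<in> reach N s' y" by auto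
        show ?thesis
        proof (cases "y = u")
          case False
          then have "u < y" using umin[OF y(1)] by simp
          then have "u \<in> N y" using elim_orderD(2)[OF eo] y uN by blast
          moreover have "y \<in> M v" using \<open>u < y\<close> y uN by (simp add: M_iff)
          ultimately show ?thesis using split[OF _ y(2)] s by auto
        qed (use y in simp)
      qed simp
    qed
    then have "card (reach N s v) \<le> card (reach M s v \<union> reach N s' u)"
      by (intro card_mono) (auto simp: finite_reach M eo)
    also have "\<dots> \<le> card (reach M s v) + card (reach N s' u)" by (rule card_Un_le)
    also have "\<dots> \<le> ((s + t') choose t') + ((s' + t) choose t)"
    proof (rule add_mono)
      show "card (reach M s v) \<le> (s + t') choose t'"
        by (rule Suc.hyps(1)) (use Suc.hyps t M cM in auto)
      show "card (reach N s' u) \<le> (s' + t) choose t"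
        by (rule Suc.hyps(1)) (use Suc.hyps s Suc.prems in auto)
    qed
    also have "\<dots> = (s + t) choose t" by (simp add: s t)
    finally show ?thesis .
  qed
qed

section \<open>Rooted trees and tree decompositions\<close>

lemma adj_in_rtrancl_sym:
  assumes "(x, y) \<in> (adj_in G S)\<^sup>*"
  shows "(y, x) \<in> (adj_in G S)\<^sup>*"
proof -
  have "sym (adj_in G S)" by (auto simp: sym_def adj_in_def insert_commute)
  then show ?thesis using assms by (meson sym_rtrancl symD)
qed

lemma connected_in_hub:
  assumes "c \<in> S" "\<And>x. x \<in> S \<Longrightarrow> (x, c) \<in> (adj_in G S)\<^sup>*"
  shows "connected_in G S"
  unfolding connected_in_def
  using assms by (meson adj_in_rtrancl_sym empty_iff rtrancl_trans)

text \<open>Take distances from an arbitrary root and let each other vertex choose a neighbour one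
  level closer. The chosen edges are distinct, since two vertices cannot be each other's parent; as
  there are as many of them as vertices other than the root, the edge count of a tree leaves no
  further edge.\<close>

lemma tree_parent:
  assumes "is_tree T"
  obtains \<rho> p d where "\<rho> \<in> verts T" "d \<rho> = (0::nat)"
    "\<And>x. x \<in> verts T \<Longrightarrow> x \<noteq> \<rho> \<Longrightarrow> p x \<in> verts T \<and> d x = Suc (d (p x))"
    "edges T = (\<lambda>x. {x, p x}) ` (verts T - {\<rho>})"
proof -
  let ?V = "verts T"
  let ?A = "adj_in T ?V"
  have g: "graph T" and con: "connected_in T ?V" and crd: "card (edges T) + 1 = card ?V"
    using assms by (auto simp: is_tree_def)
  obtain \<rho> where \<rho>: "\<rho> \<in> ?V" using con by (auto simp: connected_in_def)
  define d where "d = (\<lambda>x. LEAST k. (\<rho>, x) \<in> ?A ^^ k)"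
  have d_in: "(\<rho>, x) \<in> ?A ^^ d x" if "x \<in> ?V" for x
  proof -
    have "(\<rho>, x) \<in> ?A\<^sup>*" using con \<rho> that by (auto simp: connected_in_def)
    then obtain k where "(\<rho>, x) \<in> ?A ^^ k" using rtrancl_imp_relpow by blast
    then show ?thesis unfolding d_def by (rule LeastI)
  qed
  have d_le: "d x \<le> k" if "(\<rho>, x) \<in> ?A ^^ k" for x k
    unfolding d_def using that by (rule Least_le)
  have d0: "d \<rho> = 0" using d_le[of \<rho> 0] by simp
  have ex: "\<exists>y. y \<in> ?V \<and> {x, y} \<in> edges T \<and> d x = Suc (d y)" if x: "x \<in> ?V" "x \<noteq> \<rho>" for x
  proof -
    obtain k where k: "d x = Suc k" using d_in[OF x(1)] x(2) by (cases "d x") auto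
    with d_in[OF x(1)] obtain y where y: "(\<rho>, y) \<in> ?A ^^ k" "(y, x) \<in> ?A" by auto
    have yV: "y \<in> ?V" "{x, y} \<in> edges T" using y(2) by (auto simp: adj_in_def insert_commute)
    have "(\<rho>, x) \<in> ?A ^^ Suc (d y)" using d_in[OF yV(1)] y(2) by auto
    then have "d x \<le> Suc (d y)" by (rule d_le)
    with d_le[OF y(1)] k show ?thesis using yV by auto
  qed
  define p where "p = (\<lambda>x. SOME y. y \<in> ?V \<and> {x, y} \<in> edges T \<and> d x = Suc (d y))"
  have p: "p x \<in> ?V \<and> {x, p x} \<in> edges T \<and> d x = Suc (d (p x))" if "x \<in> ?V" "x \<noteq> \<rho>" for x
    unfolding p_def by (rule someI_ex[OF ex[OF that]])
  have inj: "inj_on (\<lambda>x. {x, p x}) (?V - {\<rho>})"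
  proof (rule inj_onI)
    fix x y assume xy: "x \<in> ?V - {\<rho>}" "y \<in> ?V - {\<rho>}" "{x, p x} = {y, p y}"
    then have "x = y \<or> x = p y \<and> y = p x" by (auto simp: doubleton_eq_iff)
    moreover have "d x = Suc (d (p x))" "d y = Suc (d (p y))" using p xy by auto
    ultimately show "x = y" by (metis Suc_n_not_le_n le_SucI order_refl)
  qed
  have fV: "finite ?V" using g by (simp add: graph_def)
  have "edges T \<subseteq> Pow ?V" using g unfolding graph_def by fastforce
  then have fE: "finite (edges T)" using fV finite_subset by blast
  have "(\<lambda>x. {x, p x}) ` (?V - {\<rho>}) = edges T"
  proof (rule card_subset_eq[OF fE])
    show "(\<lambda>x. {x, p x}) ` (?V - {\<rho>}) \<subseteq> edges T" using p by auto
    show "card ((\<lambda>x. {x, p x}) ` (?V - {\<rho>})) = card (edges T)"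
      using card_image[OF inj] \<rho> fV crd by simp
  qed
  then show ?thesis using that[of \<rho> d p] \<rho> d0 p by auto
qed

text \<open>A walk inside S from x can leave the set of descendants of x only through the parent of x.\<close>
lemma connected_parent_closed:
  assumes root: "d \<rho> = (0::nat)"
    and par: "\<And>x. x \<in> verts T \<Longrightarrow> x \<noteq> \<rho> \<Longrightarrow> p x \<in> verts T \<and> d x = Suc (d (p x))"
    and E: "edges T = (\<lambda>x. {x, p x}) ` (verts T - {\<rho>})"
    and S: "S \<subseteq> verts T" "connected_in T S"
    and m: "m \<in> S" "\<And>y. y \<in> S \<Longrightarrow> d m \<le> d y"
    and x: "x \<in> S" "x \<noteq> m"
  shows "p x \<in> S \<and> d x = Suc (d (p x))"
proof -
  have xr: "x \<noteq> \<rho>"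
  proof
    assume "x = \<rho>"
    then have "d m = 0" using m(2)[OF x(1)] root by simp
    moreover have "d m = Suc (d (p m))" using par[of m] \<open>x = \<rho>\<close> x S m by auto
    ultimately show False by simp
  qed
  have "p x \<in> S"
  proof (rule ccontr)
    assume np: "p x \<notin> S"
    \<comment> \<open>Invariant of the walk: y is a descendant of x, k levels below it. At y = m
      this contradicts the minimal depth of m, because x and m differ.\<close>
    have "\<exists>k. (p ^^ k) y = x \<and> d y = d x + k" if "(x, y) \<in> (adj_in T S)\<^sup>*" for y
      using that
    proof (induction rule: rtrancl_induct)
      case base
      show ?case by (rule exI[of _ 0]) simp
    next
      case (step y z)
      obtain k where k: "(p ^^ k) y = x" "d y = d x + k" using step.IH by blast
      have yz: "y \<in> S" "z \<in> S" "{y, z} \<in> edges T" using step.hyps by (auto simp: adj_in_def)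
      then obtain w where w: "w \<in> verts T" "w \<noteq> \<rho>" "{y, z} = {w, p w}" using E by auto
      have dw: "d w = Suc (d (p w))" using par w by auto
      consider "y = w" "z = p w" | "z = w" "y = p w" using w(3) by (auto simp: doubleton_eq_iff)
      then show ?case
      proof cases
        case 1
        show ?thesis
        proof (cases k)
          case 0
          then show ?thesis using 1 k np yz by auto
        next
          case (Suc j)
          then have "(p ^^ j) z = x" using k(1) 1 by (simp add: funpow_swap1)
          then show ?thesis using 1 k Suc dw by auto
        qed
      next
        case 2
        then have "(p ^^ Suc k) z = x" using k(1) by (simp add: funpow_swap1)
        then show ?thesis using 2 k dw by (intro exI[of _ "Suc k"]) auto
      qed
    qed
    moreover have "(x, m) \<in> (adj_in T S)\<^sup>*" using S(2) m(1) x(1) by (auto simp: connected_in_def)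
    ultimately obtain k where "(p ^^ k) m = x" "d m = d x + k" by blast
    then show False using m(2)[OF x(1)] x(2) by auto
  qed
  then show ?thesis using par xr x S by auto
qed

section \<open>Elimination orders from tree decompositions\<close>

text \<open>An element with the largest value of f is removed and given the last rank; ties are
  broken arbitrarily. Ranks start at 1, which keeps 0 free for the extra root of
  \<open>parent_tree\<close>.\<close>

lemma ex_monotone_ranking:
  assumes "finite A"
  shows "\<exists>\<phi>. bij_betw \<phi> A {1..card A} \<and> (\<forall>u\<in>A. \<forall>v\<in>A. (f u :: nat) < f v \<longrightarrow> \<phi> u < (\<phi> v :: nat))"
  using assms
proof (induction "card A" arbitrary: A)
  case 0
  then show ?case by (auto simp: bij_betw_def)
next
  case (Suc n)
  then have ne: "A \<noteq> {}" and fin: "finite A" by auto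
  have "Max (f ` A) \<in> f ` A" using ne fin by simp
  then obtain a where a: "a \<in> A" "f a = Max (f ` A)" by auto
  have amax: "f u \<le> f a" if "u \<in> A" for u using a fin that by auto
  have c: "n = card (A - {a})" using Suc.hyps(2) a fin by simp
  obtain \<phi> where \<phi>: "bij_betw \<phi> (A - {a}) {1..n}"
    and mono: "\<forall>u\<in>A - {a}. \<forall>v\<in>A - {a}. f u < f v \<longrightarrow> \<phi> u < \<phi> v"
    using Suc.hyps(1)[OF c] fin c by auto
  have rng: "\<phi> u \<le> n" if "u \<in> A" "u \<noteq> a" for u using bij_betw_apply[OF \<phi>, of u] that by auto
  define \<psi> where "\<psi> = \<phi>(a := Suc n)"
  have "bij_betw \<psi> (A - {a}) {1..n}" using \<phi> by (subst bij_betw_cong[of _ _ \<phi>]) (auto simp: \<psi>_def)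
  then have "bij_betw \<psi> (insert a (A - {a})) (insert (\<psi> a) {1..n})"
    by (subst notIn_Un_bij_betw3[symmetric, unfolded Un_insert_right Un_empty_right, of a _ \<psi> "{1..n}"])
      (auto simp: \<psi>_def)
  moreover have "insert a (A - {a}) = A" using a by auto
  moreover have "insert (\<psi> a) {1..n} = {1..card A}" using Suc.hyps(2) by (auto simp: \<psi>_def)
  ultimately have b: "bij_betw \<psi> A {1..card A}" by simp
  have "\<psi> u < \<psi> v" if "u \<in> A" "v \<in> A" "f u < f v" for u v
    using mono that rng[of u] amax[of v] by (cases "u = a"; cases "v = a") (auto simp: \<psi>_def)
  with b show ?case by blast
qed

text \<open>The vertices are ordered by the depth of the topmost node whose bag contains them.\<close>
lemma elim_order_of_tree_decomp:
  assumes "graph H" "tree_decomp_width_le H T B k"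
  obtains \<phi> N where "bij_betw \<phi> (verts H) {1..card (verts H)}" "elim_order N"
    "\<And>i. card (N i) \<le> k" "\<And>i. N i \<subseteq> {1..}"
    "\<And>u v. {u, v} \<in> edges H \<Longrightarrow> \<phi> u \<in> N (\<phi> v) \<or> \<phi> v \<in> N (\<phi> u)"
proof -
  let ?V = "verts T"
  have T: "is_tree T" and bag: "\<And>x. x \<in> ?V \<Longrightarrow> B x \<subseteq> verts H \<and> card (B x) \<le> k + 1"
    and cov: "\<And>v. v \<in> verts H \<Longrightarrow> \<exists>x\<in>?V. v \<in> B x"
    and ecov: "\<And>u v. {u, v} \<in> edges H \<Longrightarrow> \<exists>x\<in>?V. u \<in> B x \<and> v \<in> B x"
    and con: "\<And>v. v \<in> verts H \<Longrightarrow> connected_in T {x\<in>?V. v \<in> B x}"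
    using assms(2) unfolding tree_decomp_width_le_def by auto
  have fH: "finite (verts H)" using assms(1) by (simp add: graph_def)
  obtain \<rho> p d where root: "d \<rho> = (0::nat)"
    and par: "\<And>x. x \<in> ?V \<Longrightarrow> x \<noteq> \<rho> \<Longrightarrow> p x \<in> ?V \<and> d x = Suc (d (p x))"
    and E: "edges T = (\<lambda>x. {x, p x}) ` (?V - {\<rho>})"
    by (rule tree_parent[OF T]) blast
  define top where "top = (\<lambda>v. arg_min d (\<lambda>x. x \<in> ?V \<and> v \<in> B x))"
  have top: "top v \<in> ?V" "v \<in> B (top v)" if "v \<in> verts H" for v
    using arg_min_natI[of "\<lambda>x. x \<in> ?V \<and> v \<in> B x" _ d] cov[OF that] unfolding top_def by blast+
  have top_le: "d (top v) \<le> d x" if "x \<in> ?V" "v \<in> B x" for v x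
    unfolding top_def using that by (intro arg_min_nat_le) auto
  have up: "p x \<in> ?V \<and> v \<in> B (p x) \<and> d x = Suc (d (p x))"
    if "v \<in> verts H" "x \<in> ?V" "v \<in> B x" "x \<noteq> top v" for v x
    using connected_parent_closed[OF root par E _ con[OF that(1)], of "top v" x] that top top_le by auto
  \<comment> \<open>From a common bag at x, climb to \<open>top w\<close>. The parent keeps w, and
    it keeps u as well because x lies deeper than \<open>top w\<close> and so cannot be
    \<open>top u\<close>.\<close>
  have climb: "u \<in> B (top w)"
    if "u \<in> verts H" "w \<in> verts H" "x \<in> ?V" "u \<in> B x" "w \<in> B x" "d (top u) \<le> d (top w)" for u w x
    using that
  proof (induction "d x" arbitrary: x rule: less_induct)
    case less
    show ?case
    proof (cases "x = top w")
      case False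
      have w: "p x \<in> ?V" "w \<in> B (p x)" "d x = Suc (d (p x))"
        using up[of w x] less.prems False by auto
      have "d (top w) \<le> d (p x)" using top_le w by blast
      then have "x \<noteq> top u" using w less.prems by auto
      then have "u \<in> B (p x)" using up[of u x] less.prems by auto
      then show ?thesis using less.hyps[of "p x"] w less.prems by auto
    qed (use less.prems in simp)
  qed
  obtain \<phi> where \<phi>: "bij_betw \<phi> (verts H) {1..card (verts H)}"
    and mono: "\<And>u v. u \<in> verts H \<Longrightarrow> v \<in> verts H \<Longrightarrow> d (top u) < d (top v) \<Longrightarrow> \<phi> u < \<phi> v"
    using ex_monotone_ranking[OF fH, of "\<lambda>v. d (top v)"] by blast
  have inj: "inj_on \<phi> (verts H)" using \<phi> by (simp add: bij_betw_def)
  have mono': "d (top u) \<le> d (top v)" if "u \<in> verts H" "v \<in> verts H" "\<phi> u < \<phi> v" for u v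
    using mono[of v u] that by force
  \<comment> \<open>The topmost bag of v becomes a clique. Since v itself lies in that bag, at most
    k other vertices remain as earlier neighbours; numbers that are not ranks get the empty
    set.\<close>
  define N where "N = (\<lambda>i. {\<phi> u | u v. v \<in> verts H \<and> \<phi> v = i \<and> u \<in> B (top v) \<and> \<phi> u < i})"
  have BH: "u \<in> verts H" if "v \<in> verts H" "u \<in> B (top v)" for u v
    using bag[OF top(1)[OF that(1)]] that by blast
  have NI: "\<phi> u \<in> N (\<phi> v)" if "v \<in> verts H" "u \<in> B (top v)" "\<phi> u < \<phi> v" for u v
    unfolding N_def using that by blast
  have "elim_order N"
    unfolding elim_order_def
  proof (intro conjI allI ballI impI)
    fix i j assume "j \<in> N i" then show "j < i" by (auto simp: N_def)
  next
    fix i a b assume ab: "a \<in> N i" "b \<in> N i" "a < b"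
    obtain u v where u: "a = \<phi> u" "v \<in> verts H" "\<phi> v = i" "u \<in> B (top v)" using ab by (auto simp: N_def)
    obtain w v' where w: "b = \<phi> w" "v' \<in> verts H" "\<phi> v' = i" "w \<in> B (top v')" using ab by (auto simp: N_def)
    have "v' = v" using inj u w by (auto dest: inj_onD)
    then have uw: "u \<in> verts H" "w \<in> verts H" using BH u w by auto
    \<comment> \<open>Both u and w lie in the bag at \<open>top v\<close>, which serves as the
      starting point of the climb.\<close>
    have "u \<in> B (top w)"
      using climb[OF uw, of "top v"] top[OF u(2)] u w \<open>v' = v\<close> mono'[OF uw] ab(3) by auto
    then show "a \<in> N b" using NI[of w u] uw u w ab(3) by auto
  qed
  moreover have "card (N i) \<le> k" for i
  proof (cases "\<exists>v\<in>verts H. \<phi> v = i")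
    case True
    then obtain v where v: "v \<in> verts H" "\<phi> v = i" by blast
    have fB: "finite (B (top v))" using bag[OF top(1)[OF v(1)]] fH finite_subset by blast
    have "N i \<subseteq> \<phi> ` (B (top v) - {v})"
      using inj v by (auto simp: N_def dest!: inj_onD)
    then have "card (N i) \<le> card (\<phi> ` (B (top v) - {v}))" using fB by (intro card_mono) auto
    also have "\<dots> \<le> card (B (top v) - {v})" using fB by (intro card_image_le) auto
    also have "\<dots> \<le> k" using bag[OF top(1)[OF v(1)]] top(2)[OF v(1)] fB by (simp add: le_diff_conv)
    finally show ?thesis .
  next
    case False
    then have "N i = {}" by (auto simp: N_def)
    then show ?thesis by simp
  qed
  moreover have "N i \<subseteq> {1..}" for i
    using bij_betw_apply[OF \<phi>] BH by (fastforce simp: N_def)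
  moreover have "\<phi> u \<in> N (\<phi> v) \<or> \<phi> v \<in> N (\<phi> u)" if e: "{u, v} \<in> edges H" for u v
  proof -
    have uv: "u \<in> verts H" "v \<in> verts H" "u \<noteq> v"
      using assms(1) e unfolding graph_def by (fastforce simp: doubleton_eq_iff)+
    obtain x where x: "x \<in> ?V" "u \<in> B x" "v \<in> B x" using ecov[OF e] by blast
    have "\<phi> u \<noteq> \<phi> v" using inj uv by (auto dest: inj_onD)
    then consider "\<phi> u < \<phi> v" | "\<phi> v < \<phi> u" by linarith
    then show ?thesis
    proof cases
      case 1
      then show ?thesis using climb[of u v x] mono'[of u v] NI[of v u] uv x by auto
    next
      case 2
      then show ?thesis using climb[of v u x] mono'[of v u] NI[of u v] uv x by auto
    qed
  qed
  ultimately show ?thesis using that[OF \<phi>] by blast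
qed

lemma treewidth_le: "tree_decomp_width_le G T B k \<Longrightarrow> treewidth G \<le> k"
  unfolding treewidth_def by (rule Least_le) blast

lemma tree_decomp_mono: "tree_decomp_width_le G T B k \<Longrightarrow> k \<le> k' \<Longrightarrow> tree_decomp_width_le G T B k'"
  unfolding tree_decomp_width_le_def by fastforce

text \<open>A single bag holding all vertices shows that the minimum defining
  \<open>treewidth\<close> is attained.\<close>

lemma tree_decomp_treewidth:
  assumes "graph G"
  obtains T B where "tree_decomp_width_le G T B (treewidth G)"
proof -
  have "tree_decomp_width_le G ({0}, {}) (\<lambda>_. verts G) (card (verts G))"
    using assms
    by (fastforce simp: tree_decomp_width_le_def is_tree_def graph_def connected_in_def doubleton_eq_iff)
  then have "\<exists>k T B. tree_decomp_width_le G T B k" by blast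
  then have "\<exists>T B. tree_decomp_width_le G T B (treewidth G)" unfolding treewidth_def by (rule LeastI_ex)
  then show ?thesis using that by blast
qed

section \<open>Tree decomposition of the reachability graph\<close>

text \<open>Node 0 is an additional root below which vertices without earlier neighbours will hang,
  so that a disconnected graph still gives one tree.\<close>

definition parent_tree :: "nat \<Rightarrow> (nat \<Rightarrow> nat) \<Rightarrow> nat graph" where
  "parent_tree n p = ({0..n}, (\<lambda>x. {x, p x}) ` {1..n})"

lemma parent_tree_connected:
  assumes "S \<subseteq> {0..n}" "c \<in> S" "\<And>x. x \<in> S \<Longrightarrow> x \<noteq> c \<Longrightarrow> x \<ge> 1 \<and> p x \<in> S \<and> p x < x"
  shows "connected_in (parent_tree n p) S"
proof (rule connected_in_hub[OF assms(2)])
  fix x assume "x \<in> S"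
  then show "(x, c) \<in> (adj_in (parent_tree n p) S)\<^sup>*"
  proof (induction x rule: less_induct)
    case (less x)
    show ?case
    proof (cases "x = c")
      case False
      then have px: "x \<ge> 1" "p x \<in> S" "p x < x" using assms(3) less.prems by auto
      then have "(x, p x) \<in> adj_in (parent_tree n p) S"
        using less.prems assms(1) by (auto simp: adj_in_def parent_tree_def)
      then show ?thesis using less.IH[OF px(3,2)] by (rule converse_rtrancl_into_rtrancl)
    qed simp
  qed
qed

lemma is_tree_parent_tree:
  assumes "\<And>x. x \<ge> 1 \<Longrightarrow> p x < x"
  shows "is_tree (parent_tree n p)"
proof -
  have "connected_in (parent_tree n p) {0..n}"
  proof (rule parent_tree_connected[of _ _ 0])
    fix x assume "x \<in> {0..n}" "x \<noteq> 0"
    then show "1 \<le> x \<and> p x \<in> {0..n} \<and> p x < x" using assms[of x] by auto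
  qed auto
  moreover have "graph (parent_tree n p)"
    unfolding graph_def
  proof (intro conjI ballI)
    fix e assume "e \<in> edges (parent_tree n p)"
    then obtain x where "x \<in> {1..n}" "e = {x, p x}" by (auto simp: parent_tree_def)
    then show "\<exists>u v. e = {u, v} \<and> u \<noteq> v \<and> u \<in> verts (parent_tree n p) \<and> v \<in> verts (parent_tree n p)"
      using assms[of x] by (intro exI[of _ x] exI[of _ "p x"]) (auto simp: parent_tree_def)
  qed (simp add: parent_tree_def)
  moreover have "inj_on (\<lambda>x. {x, p x}) {1..n}"
  proof (rule inj_onI)
    fix x y assume xy: "x \<in> {1..n}" "y \<in> {1..n}" "{x, p x} = {y, p y}"
    then show "x = y" using assms[of x] assms[of y] by (auto simp: doubleton_eq_iff)
  qed
  ultimately show ?thesis by (simp add: is_tree_def parent_tree_def card_image)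
qed

definition reach_graph :: "nat \<Rightarrow> (nat \<Rightarrow> nat set) \<Rightarrow> nat \<Rightarrow> nat graph" where
  "reach_graph n N s = ({1..n}, {{a, b} | a b. a \<noteq> b \<and> (\<exists>z\<in>{1..n}. a \<in> reach N s z \<and> b \<in> reach N s z)})"

text \<open>Suppose the bag of x contains some v other than x. The parent of x, its latest earlier
  neighbour, is at least the first step of a descending walk to v and so at least v; by
  \<open>reach_via_neighbour\<close> its bag contains v too. Hence all nodes whose bag contains v
  are connected through their parents to node v.\<close>

lemma reach_graph_tree_decomp:
  assumes N: "elim_order N" "\<And>v. card (N v) \<le> t" "\<And>v. N v \<subseteq> {1..}"
  shows "graph (reach_graph n N s)"
    and "\<exists>T B. tree_decomp_width_le (reach_graph n N s) T B (((s + t) choose t) - 1)"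
proof -
  have rng: "u \<in> {1..n}" if "u \<in> reach N s z" "z \<in> {1..n}" for u z
    using reach_le[OF N(1) that(1)] reach_pos[OF N(3) that(1)] that(2) by simp
  show "graph (reach_graph n N s)"
    unfolding graph_def
  proof (intro conjI ballI)
    fix e assume "e \<in> edges (reach_graph n N s)"
    then obtain a b z where "e = {a, b}" "a \<noteq> b" "z \<in> {1..n}" "a \<in> reach N s z" "b \<in> reach N s z"
      by (auto simp: reach_graph_def)
    then show "\<exists>u v. e = {u, v} \<and> u \<noteq> v \<and> u \<in> verts (reach_graph n N s) \<and> v \<in> verts (reach_graph n N s)"
      using rng[of a z] rng[of b z] by (intro exI[of _ a] exI[of _ b]) (simp add: reach_graph_def)
  qed (simp add: reach_graph_def)
  define p where "p = (\<lambda>x. Max (insert 0 (N x)))"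
  define B where "B = (\<lambda>x. if x = 0 then {} else reach N s x)"
  have fN: "finite (N x)" for x by (rule finite_elim_order[OF N(1)])
  have p_less: "p x < x" if "x \<ge> 1" for x
    using that fN elim_orderD(1)[OF N(1)] by (auto simp: p_def)
  have parent: "p x \<in> N x \<and> u \<in> reach N s (p x)" if u: "u \<in> reach N s x" "u \<noteq> x" for u x
  proof -
    obtain s' where s: "s = Suc s'" using u by (cases s) auto
    then obtain z where z: "z \<in> N x" "u \<in> reach N s' z" using u by auto
    have zp: "z \<le> p x" using z fN by (simp add: p_def)
    \<comment> \<open>The default 0 does not win the maximum here: z is a positive element of
      \<open>N x\<close>.\<close>
    have "p x \<in> insert 0 (N x)" unfolding p_def by (rule Max_in) (use fN in auto)
    moreover have "p x \<noteq> 0" using zp z N(3) by fastforce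
    ultimately have pN: "p x \<in> N x" by simp
    have "u \<le> p x" using reach_le[OF N(1) z(2)] zp by simp
    then show ?thesis using reach_via_neighbour[OF N(1) u(1) pN] pN by blast
  qed
  have "tree_decomp_width_le (reach_graph n N s) (parent_tree n p) B (((s + t) choose t) - 1)"
    unfolding tree_decomp_width_le_def
  proof (intro conjI ballI allI impI)
    show "is_tree (parent_tree n p)" by (rule is_tree_parent_tree[OF p_less])
  next
    fix x assume "x \<in> verts (parent_tree n p)"
    then show "B x \<subseteq> verts (reach_graph n N s)"
      using rng by (auto simp: parent_tree_def B_def reach_graph_def)
  next
    fix x
    have "card (B x) \<le> (s + t) choose t" using card_reach_le[OF N(1,2)] by (simp add: B_def)
    then show "card (B x) \<le> ((s + t) choose t) - 1 + 1" by linarith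
  next
    fix v assume "v \<in> verts (reach_graph n N s)"
    then show "\<exists>x\<in>verts (parent_tree n p). v \<in> B x"
      by (intro bexI[of _ v]) (auto simp: parent_tree_def B_def reach_graph_def)
  next
    fix u v assume "{u, v} \<in> edges (reach_graph n N s)"
    then obtain z where z: "z \<in> {1..n}" "u \<in> reach N s z" "v \<in> reach N s z"
      by (auto simp: reach_graph_def doubleton_eq_iff)
    then show "\<exists>x\<in>verts (parent_tree n p). u \<in> B x \<and> v \<in> B x"
      by (intro bexI[of _ z]) (auto simp: parent_tree_def B_def)
  next
    fix v assume v: "v \<in> verts (reach_graph n N s)"
    show "connected_in (parent_tree n p) {x \<in> verts (parent_tree n p). v \<in> B x}"
    proof (rule parent_tree_connected[of _ _ v])
      fix x assume x: "x \<in> {x \<in> verts (parent_tree n p). v \<in> B x}" "x \<noteq> v"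
      then have x1: "x \<ge> 1" "x \<le> n" "v \<in> reach N s x"
        by (auto simp: parent_tree_def B_def split: if_splits)
      have "p x \<in> N x" "v \<in> reach N s (p x)" using parent x1 x(2) by auto
      moreover have "p x \<ge> 1" using \<open>p x \<in> N x\<close> N(3) by fastforce
      ultimately show "1 \<le> x \<and> p x \<in> {x \<in> verts (parent_tree n p). v \<in> B x} \<and> p x < x"
        using p_less[OF x1(1)] x1 by (auto simp: parent_tree_def B_def)
    qed (use v in \<open>auto simp: parent_tree_def B_def reach_graph_def\<close>)
  qed
  then show "\<exists>T B. tree_decomp_width_le (reach_graph n N s) T B (((s + t) choose t) - 1)" by blast
qed

section \<open>Strong products\<close>

lemma strong_prod_edge_iff:
  "{(a, v), (b, u)} \<in> edges (G1 \<boxtimes> G2) \<longleftrightarrow>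
     a \<in> verts G1 \<and> b \<in> verts G1 \<and> v \<in> verts G2 \<and> u \<in> verts G2 \<and> (a, v) \<noteq> (b, u) \<and>
     (a = b \<or> {a, b} \<in> edges G1) \<and> (v = u \<or> {v, u} \<in> edges G2)" (is "?L \<longleftrightarrow> ?R")
proof
  assume ?L
  then show ?R unfolding strong_prod_def by (auto simp: doubleton_eq_iff insert_commute)
next
  assume R: ?R
  then have "(a, v) \<noteq> (b, u)" "{a, b} \<in> edges G1 \<and> u = v \<or> a = b \<and> {u, v} \<in> edges G2 \<or>
      {a, b} \<in> edges G1 \<and> {u, v} \<in> edges G2" by (auto simp: insert_commute)
  with R show ?L unfolding strong_prod_def snd_conv mem_Collect_eq by blast
qed

lemma strong_prod_verts [simp]: "verts (G1 \<boxtimes> G2) = verts G1 \<times> verts G2"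
  by (simp add: strong_prod_def)

lemma complete_verts [simp]: "verts (K l) = {0..<l}"
  by (simp add: complete_def)

lemma complete_edge_iff: "{i, j} \<in> edges (K l) \<longleftrightarrow> i < l \<and> j < l \<and> i \<noteq> j"
  by (auto simp: complete_def doubleton_eq_iff)

text \<open>Positions turn the rows of the product into numbers, so that walks can be measured and
  rows cut into blocks by division.\<close>

lemma is_path_index:
  assumes "is_path P"
  obtains xs ix where "xs \<noteq> []"
    "\<And>i. i < length xs \<Longrightarrow> xs ! i \<in> verts P \<and> ix (xs ! i) = i"
    "\<And>p. p \<in> verts P \<Longrightarrow> ix p < length xs \<and> xs ! ix p = p"
    "\<And>p q. {p, q} \<in> edges P \<Longrightarrow> ix p = Suc (ix q) \<or> ix q = Suc (ix p)"
    "\<And>i. Suc i < length xs \<Longrightarrow> {xs ! i, xs ! Suc i} \<in> edges P"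
proof -
  obtain xs where xs: "xs \<noteq> []" "distinct xs" "set xs = verts P"
    and E: "edges P = {{xs ! i, xs ! (i + 1)} | i. i + 1 < length xs}"
    using assms by (auto simp: is_path_def)
  define ix where "ix = (\<lambda>p. SOME i. i < length xs \<and> xs ! i = p)"
  have ix: "ix p < length xs \<and> xs ! ix p = p" if "p \<in> verts P" for p
    unfolding ix_def by (rule someI_ex) (use that xs in \<open>metis in_set_conv_nth\<close>)
  have nth: "xs ! i \<in> verts P \<and> ix (xs ! i) = i" if "i < length xs" for i
    using ix[of "xs ! i"] xs that by (metis nth_eq_iff_index_eq nth_mem)
  show ?thesis
  proof (rule that[OF xs(1) nth ix])
    fix p q assume "{p, q} \<in> edges P"
    then obtain i where "Suc i < length xs" "{p, q} = {xs ! i, xs ! Suc i}" using E by auto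
    then show "ix p = Suc (ix q) \<or> ix q = Suc (ix p)"
      using nth[of i] nth[of "Suc i"] by (auto simp: doubleton_eq_iff)
  qed (use E in auto)
qed

section \<open>Embedding the shallow minor\<close>

lemma relpow_adj_in_sym: "(x, y) \<in> adj_in G S ^^ k \<Longrightarrow> (y, x) \<in> adj_in G S ^^ k"
proof (induction k arbitrary: y)
  case (Suc k)
  then obtain z where "(x, z) \<in> adj_in G S ^^ k" "(z, y) \<in> adj_in G S" by auto
  then have "(z, x) \<in> adj_in G S ^^ k" "(y, z) \<in> adj_in G S"
    using Suc.IH by (auto simp: adj_in_def insert_commute)
  then show ?case by (rule relpow_Suc_I2[rotated])
qed simp

text \<open>A vertex v of G is placed at the earliest vertex of H met by its branch set, and in the block
  of \<open>2r+1\<close> consecutive rows that contains the centre of the branch set. Within a block, the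
  representative in the earliest fibre lies in one of \<open>4r+1 \<le> (2r+1)\<^sup>2\<close> rows.\<close>
lemma shallow_minor_contained:
  fixes G :: "'g graph" and H :: "'h graph" and P :: "'p graph"
  assumes G: "graph G" and P: "is_path P"
    and \<phi>: "bij_betw \<phi> (verts H) {1..n}" and N: "elim_order N"
    and HN: "\<And>u v. {u, v} \<in> edges H \<Longrightarrow> \<phi> u \<in> N (\<phi> v) \<or> \<phi> v \<in> N (\<phi> u)"
    and sm: "shallow_minor r G (H \<boxtimes> P \<boxtimes> K l)"
  shows "contained G (reach_graph n N (2*r+1) \<boxtimes> P \<boxtimes> K (l * (2*r+1)^2))"
proof -
  let ?G' = "H \<boxtimes> P \<boxtimes> K l"
  let ?J = "reach_graph n N (2*r+1)"
  let ?w = "2*r+1"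
  obtain \<mu> where model: "is_model G ?G' \<mu>" and rad: "\<And>v. v \<in> verts G \<Longrightarrow> radius_le ?G' (\<mu> v) r"
    using sm by (auto simp: shallow_minor_def)
  have sub: "\<mu> v \<subseteq> verts ?G'" if "v \<in> verts G" for v using model that unfolding is_model_def by blast
  have disj: "\<mu> v \<inter> \<mu> w = {}" if "v \<in> verts G" "w \<in> verts G" "v \<noteq> w" for v w
    using model that unfolding is_model_def by blast
  have medge: "\<exists>x\<in>\<mu> v. \<exists>y\<in>\<mu> w. {x, y} \<in> edges ?G'" if "{v, w} \<in> edges G" for v w
    using model that unfolding is_model_def by blast
  obtain xs ix where xs: "xs \<noteq> []" "\<And>i. i < length xs \<Longrightarrow> xs ! i \<in> verts P \<and> ix (xs ! i) = i"
    "\<And>p. p \<in> verts P \<Longrightarrow> ix p < length xs \<and> xs ! ix p = p"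
    "\<And>p q. {p, q} \<in> edges P \<Longrightarrow> ix p = Suc (ix q) \<or> ix q = Suc (ix p)"
    "\<And>i. Suc i < length xs \<Longrightarrow> {xs ! i, xs ! Suc i} \<in> edges P"
    by (rule is_path_index[OF P]) blast
  define \<alpha> :: "('h \<times> 'p) \<times> nat \<Rightarrow> nat" where "\<alpha> = (\<lambda>x. \<phi> (fst (fst x)))"
  define \<rho> :: "('h \<times> 'p) \<times> nat \<Rightarrow> nat" where "\<rho> = (\<lambda>x. ix (snd (fst x)))"
  have step: "(\<alpha> x = \<alpha> y \<or> \<alpha> x \<in> N (\<alpha> y) \<or> \<alpha> y \<in> N (\<alpha> x)) \<and> \<rho> x \<le> Suc (\<rho> y) \<and> \<rho> y \<le> Suc (\<rho> x)"
    if e: "{x, y} \<in> edges ?G'" for x y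
  proof -
    obtain a p i b q j where xy: "x = ((a, p), i)" "y = ((b, q), j)" by (metis prod.exhaust)
    from e have "(a, p) = (b, q) \<or> {(a, p), (b, q)} \<in> edges (H \<boxtimes> P)"
      unfolding xy strong_prod_edge_iff by blast
    then have "(a = b \<or> {a, b} \<in> edges H) \<and> (p = q \<or> {p, q} \<in> edges P)"
      unfolding strong_prod_edge_iff by blast
    then show ?thesis using HN[of a b] xs(4)[of p q] unfolding xy \<alpha>_def \<rho>_def by auto
  qed
  have walk_row: "\<rho> x \<le> \<rho> y + k \<and> \<rho> y \<le> \<rho> x + k" if "(x, y) \<in> adj_in ?G' S ^^ k" for x y S k
    using that
  proof (induction k arbitrary: y)
    case (Suc k)
    then obtain z where z: "(x, z) \<in> adj_in ?G' S ^^ k" "(z, y) \<in> adj_in ?G' S" by auto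
    show ?case using Suc.IH[OF z(1)] step[of z y] z(2) by (auto simp: adj_in_def)
  qed simp
  \<comment> \<open>Each edge of the product is at most one edge of the chordal graph, in either
    direction. As all of S ranks at or above u, \<open>reach_step\<close> applies along the whole
    walk.\<close>
  have walk_reach: "u \<in> reach N (s + k) (\<alpha> y)"
    if "(x, y) \<in> adj_in ?G' S ^^ k" "u \<in> reach N s (\<alpha> x)" "\<And>z. z \<in> S \<Longrightarrow> u \<le> \<alpha> z" for x y S k u s
    using that(1)
  proof (induction k arbitrary: y)
    case 0
    then show ?case using that(2) by simp
  next
    case (Suc k)
    then obtain z where z: "(x, z) \<in> adj_in ?G' S ^^ k" "(z, y) \<in> adj_in ?G' S" by auto
    have "{z, y} \<in> edges ?G'" "y \<in> S" using z(2) by (auto simp: adj_in_def)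
    then show ?case using reach_step[OF N Suc.IH[OF z(1)], of "\<alpha> y"] step[of z y] that(3)
      by (auto simp del: reach.simps)
  qed
  have "\<exists>c. c \<in> \<mu> v \<and> (\<forall>x\<in>\<mu> v. \<exists>k\<le>r. (c, x) \<in> adj_in ?G' (\<mu> v) ^^ k)" if "v \<in> verts G" for v
    using rad[OF that] unfolding radius_le_def by blast
  then obtain c where c: "\<And>v. v \<in> verts G \<Longrightarrow> c v \<in> \<mu> v"
    and cr: "\<And>v x. v \<in> verts G \<Longrightarrow> x \<in> \<mu> v \<Longrightarrow> \<exists>k\<le>r. (c v, x) \<in> adj_in ?G' (\<mu> v) ^^ k"
    by metis
  define a where "a = (\<lambda>v. arg_min \<alpha> (\<lambda>x. x \<in> \<mu> v))"
  have a: "a v \<in> \<mu> v" if "v \<in> verts G" for v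
    unfolding a_def using c[OF that] by (rule arg_min_natI)
  have a_le: "\<alpha> (a v) \<le> \<alpha> x" if "x \<in> \<mu> v" for v x
    unfolding a_def using that by (rule arg_min_nat_le)
  have row_c: "\<rho> (c v) \<le> \<rho> x + r \<and> \<rho> x \<le> \<rho> (c v) + r" if "v \<in> verts G" "x \<in> \<mu> v" for v x
    using cr[OF that] walk_row by fastforce
  \<comment> \<open>The walk from \<open>a v\<close> to x goes through the centre, at most r steps
    each way. One further edge to another branch set will account for the radius 2r+1.\<close>
  have bag: "\<alpha> (a v) \<in> reach N (2*r) (\<alpha> x)" if v: "v \<in> verts G" and x: "x \<in> \<mu> v" for v x
  proof -
    obtain j where j: "j \<le> r" "(c v, a v) \<in> adj_in ?G' (\<mu> v) ^^ j" using cr[OF v a[OF v]] by blast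
    obtain k where k: "k \<le> r" "(c v, x) \<in> adj_in ?G' (\<mu> v) ^^ k" using cr[OF v x] by blast
    have "\<alpha> (a v) \<in> reach N (0 + j) (\<alpha> (c v))"
      by (rule walk_reach[OF relpow_adj_in_sym[OF j(2)]]) (use a_le in auto)
    then have "\<alpha> (a v) \<in> reach N (0 + j + k) (\<alpha> x)"
      by (rule walk_reach[OF k(2)]) (use a_le in auto)
    then show ?thesis by (rule reach_mono) (use j k in simp)
  qed
  have vG': "fst (fst x) \<in> verts H \<and> snd (fst x) \<in> verts P \<and> snd x < l" if "v \<in> verts G" "x \<in> \<mu> v" for v x
    using sub[OF that(1)] that(2) by auto
  have \<alpha>_rng: "\<alpha> x \<in> {1..n}" if "v \<in> verts G" "x \<in> \<mu> v" for v x
    using vG'[OF that] bij_betw_apply[OF \<phi>] by (simp add: \<alpha>_def)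
  \<comment> \<open>The row of \<open>a v\<close> is within r of the centre's row, which lies in
    block \<open>q v\<close>; the shift by r in \<open>off\<close> thus keeps it between 0 and 4r.
    The offset and the coordinate in \<open>K l\<close> are packed into \<open>num\<close> as digits
    to base l.\<close>
  define q where "q = (\<lambda>v. \<rho> (c v) div ?w)"
  define off where "off = (\<lambda>v. \<rho> (a v) + r - q v * ?w)"
  define num where "num = (\<lambda>v. off v * l + snd (a v))"
  define f where "f = (\<lambda>v. ((\<alpha> (a v), xs ! q v), num v))"
  have q_bounds: "q v * ?w \<le> \<rho> (c v) \<and> \<rho> (c v) \<le> q v * ?w + 2*r" for v
  proof -
    have "\<rho> (c v) = q v * ?w + \<rho> (c v) mod ?w" unfolding q_def by (rule div_mult_mod_eq[symmetric])
    moreover have "\<rho> (c v) mod ?w < ?w" by (rule mod_less_divisor) simp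
    ultimately show ?thesis by linarith
  qed
  \<comment> \<open>Block numbers never exceed row numbers, so P itself is long enough to carry the
    blocks.\<close>
  have q_len: "q v < length xs" if "v \<in> verts G" for v
  proof -
    have "\<rho> (c v) < length xs" using xs(3) vG'[OF that c[OF that]] by (simp add: \<rho>_def)
    moreover have "q v \<le> \<rho> (c v)" unfolding q_def by (rule div_le_dividend)
    ultimately show ?thesis by simp
  qed
  have off: "off v + q v * ?w = \<rho> (a v) + r" "off v \<le> 4*r" if "v \<in> verts G" for v
    using row_c[OF that a[OF that]] q_bounds[of v] unfolding off_def by linarith+
  have num: "num v < l * ?w^2" if v: "v \<in> verts G" for v
  proof -
    have "num v < (off v + 1) * l" using vG'[OF v a[OF v]] by (simp add: num_def)
    also have "\<dots> \<le> (4*r+1) * l" using off(2)[OF v] by (intro mult_le_mono1) simp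
    also have "\<dots> \<le> ?w^2 * l" by (intro mult_le_mono1) (simp add: power2_eq_square algebra_simps)
    finally show ?thesis by (simp only: mult.commute)
  qed
  \<comment> \<open>Block and offset recover the row of \<open>a v\<close>, the rank recovers its
    vertex of H, and the remainder modulo l its coordinate in \<open>K l\<close>. So
    \<open>f v\<close> determines \<open>a v\<close>, and with it v, as branch sets are
    disjoint.\<close>
  have inj: "inj_on f (verts G)"
  proof (rule inj_onI, rule ccontr)
    fix v w assume vw: "v \<in> verts G" "w \<in> verts G" "f v = f w" "v \<noteq> w"
    have l: "snd (a v) < l" "snd (a w) < l" using vG'[OF _ a] vw by auto
    have "xs ! q v = xs ! q w" "\<alpha> (a v) = \<alpha> (a w)" "num v = num w" using vw(3) by (auto simp: f_def)
    then have "q v = q w" using xs(2) q_len vw(1,2) by metis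
    have "off v = num v div l" "off w = num w div l" "snd (a v) = num v mod l" "snd (a w) = num w mod l"
      using l by (auto simp: num_def)
    then have "off v = off w" "snd (a v) = snd (a w)" using \<open>num v = num w\<close> by simp_all
    then have "\<rho> (a v) = \<rho> (a w)" using off(1)[OF vw(1)] off(1)[OF vw(2)] \<open>q v = q w\<close> by simp
    then have "snd (fst (a v)) = snd (fst (a w))"
      using xs(3) vG'[OF vw(1) a[OF vw(1)]] vG'[OF vw(2) a[OF vw(2)]] unfolding \<rho>_def by metis
    moreover have "fst (fst (a v)) = fst (fst (a w))"
      using \<open>\<alpha> (a v) = \<alpha> (a w)\<close> \<phi> vG'[OF vw(1) a[OF vw(1)]] vG'[OF vw(2) a[OF vw(2)]]
      unfolding \<alpha>_def bij_betw_def by (auto dest: inj_onD)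
    ultimately have "a v = a w" using \<open>snd (a v) = snd (a w)\<close> by (simp add: prod_eq_iff)
    then show False using disj[OF vw(1,2,4)] a[OF vw(1)] a[OF vw(2)] by auto
  qed
  have verts_f: "\<alpha> (a v) \<in> verts ?J \<and> xs ! q v \<in> verts P \<and> num v \<in> verts (K (l * ?w^2))"
    if "v \<in> verts G" for v
    using \<alpha>_rng[OF that a[OF that]] xs(2)[OF q_len[OF that]] num[OF that] by (simp add: reach_graph_def)
  have common: "\<exists>z\<in>{1..n}. \<alpha> (a v) \<in> reach N ?w z \<and> \<alpha> (a w) \<in> reach N ?w z"
    if vw: "v \<in> verts G" "w \<in> verts G" and x: "x \<in> \<mu> v" and y: "y \<in> \<mu> w" and e: "{x, y} \<in> edges ?G'"
      and le: "\<alpha> (a v) \<le> \<alpha> (a w)" for v w x y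
  proof (rule bexI[of _ "\<alpha> y"])
    have "\<alpha> (a v) \<le> \<alpha> y" using le a_le[OF y] by simp
    then have "\<alpha> (a v) \<in> reach N (Suc (2*r)) (\<alpha> y)"
      using reach_step[OF N bag[OF vw(1) x], of "\<alpha> y"] step[OF e] by blast
    moreover have "\<alpha> (a w) \<in> reach N (Suc (2*r)) (\<alpha> y)"
      using reach_Suc_mono[OF bag[OF vw(2) y]] .
    ultimately show "\<alpha> (a v) \<in> reach N ?w (\<alpha> y) \<and> \<alpha> (a w) \<in> reach N ?w (\<alpha> y)"
      by (simp del: reach.simps)
  qed (rule \<alpha>_rng[OF vw(2) y])
  have "{f v, f w} \<in> edges (?J \<boxtimes> P \<boxtimes> K (l * ?w^2))" if e: "{v, w} \<in> edges G" for v w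
  proof -
    have vw: "v \<in> verts G" "w \<in> verts G" "v \<noteq> w"
      using G e unfolding graph_def by (fastforce simp: doubleton_eq_iff)+
    obtain x y where xy: "x \<in> \<mu> v" "y \<in> \<mu> w" "{x, y} \<in> edges ?G'" using medge[OF e] by blast
    then have yx: "{y, x} \<in> edges ?G'" by (simp only: insert_commute)
    have J: "\<exists>z\<in>{1..n}. \<alpha> (a v) \<in> reach N ?w z \<and> \<alpha> (a w) \<in> reach N ?w z"
    proof (cases "\<alpha> (a v) \<le> \<alpha> (a w)")
      case True
      show ?thesis by (rule common[OF vw(1,2) xy True])
    next
      case False
      then have "\<alpha> (a w) \<le> \<alpha> (a v)" by simp
      then show ?thesis using common[OF vw(2,1) xy(2,1) yx] by blast
    qed
    then have eJ: "\<alpha> (a v) = \<alpha> (a w) \<or> {\<alpha> (a v), \<alpha> (a w)} \<in> edges ?J"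
      unfolding reach_graph_def snd_conv by blast
    \<comment> \<open>Centres of adjacent branch sets are at most r + 1 + r rows apart, exactly one
      block length, so block numbers differ by at most one.\<close>
    have "\<rho> (c v) \<le> \<rho> (c w) + ?w" "\<rho> (c w) \<le> \<rho> (c v) + ?w"
      using row_c[OF vw(1) xy(1)] row_c[OF vw(2) xy(2)] step[OF xy(3)] by linarith+
    then have "q v \<le> (\<rho> (c w) + ?w) div ?w" "q w \<le> (\<rho> (c v) + ?w) div ?w"
      unfolding q_def by (simp_all only: div_le_mono)
    moreover have "(i + ?w) div ?w = i div ?w + 1" for i by (rule div_add_self2) simp
    ultimately have "q v \<le> Suc (q w)" "q w \<le> Suc (q v)" by (simp_all only: q_def Suc_eq_plus1)
    then consider "q v = q w" | "q v = Suc (q w)" | "q w = Suc (q v)" by linarith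
    then have eP: "xs ! q v = xs ! q w \<or> {xs ! q v, xs ! q w} \<in> edges P"
    proof cases
      case 2
      then show ?thesis using xs(5)[of "q w"] q_len[OF vw(1)] by (simp add: insert_commute)
    next
      case 3
      then show ?thesis using xs(5)[of "q v"] q_len[OF vw(2)] by simp
    qed simp
    have "f v \<noteq> f w" using inj vw by (auto dest: inj_onD)
    then show ?thesis
      using eJ eP verts_f[OF vw(1)] verts_f[OF vw(2)]
      unfolding f_def strong_prod_edge_iff complete_edge_iff by auto
  qed
  moreover have "f ` verts G \<subseteq> verts (?J \<boxtimes> P \<boxtimes> K (l * ?w^2))" using verts_f by (auto simp: f_def)
  ultimately show ?thesis using inj unfolding contained_def by blast
qed

section \<open>Absorbing the complete factor and bounding row treewidth\<close>

text \<open>The vertex \<open>(j, i)\<close> of \<open>J \<boxtimes> K m\<close> is encoded as \<open>j * m + i\<close>.\<close>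
definition blowup :: "nat graph \<Rightarrow> nat \<Rightarrow> nat graph" where
  "blowup J m = ({a. a div m \<in> verts J},
     {{a, b} | a b. a div m \<in> verts J \<and> b div m \<in> verts J \<and> a \<noteq> b \<and>
        (a div m = b div m \<or> {a div m, b div m} \<in> edges J)})"

lemma div_vimage_eq:
  assumes "m \<ge> 1"
  shows "{a :: nat. a div m \<in> A} = (\<lambda>(j, i). j * m + i) ` (A \<times> {..<m})"
proof
  show "{a. a div m \<in> A} \<subseteq> (\<lambda>(j, i). j * m + i) ` (A \<times> {..<m})"
  proof
    fix a assume "a \<in> {a. a div m \<in> A}"
    then show "a \<in> (\<lambda>(j, i). j * m + i) ` (A \<times> {..<m})"
      using assms by (intro image_eqI[of _ _ "(a div m, a mod m)"]) auto
  qed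
qed auto

lemma blowup_edge_iff:
  "{a, b} \<in> edges (blowup J m) \<longleftrightarrow> a div m \<in> verts J \<and> b div m \<in> verts J \<and> a \<noteq> b \<and>
     (a div m = b div m \<or> {a div m, b div m} \<in> edges J)"
  by (auto simp: blowup_def doubleton_eq_iff insert_commute)

text \<open>The same tree is kept, with each vertex of a bag replaced by its m copies; bag sizes,
  that is width plus one, are multiplied by m.\<close>

lemma blowup_treewidth:
  assumes m: "m \<ge> 1" and J: "graph J" and td: "tree_decomp_width_le J T B k"
  shows "graph (blowup J m)" and "treewidth (blowup J m) \<le> (k + 1) * m - 1"
proof -
  have fJ: "finite (verts J)" using J by (simp add: graph_def)
  have "finite (verts (blowup J m))" using fJ by (simp add: blowup_def div_vimage_eq[OF m])
  moreover have "\<exists>u v. e = {u, v} \<and> u \<noteq> v \<and> u \<in> verts (blowup J m) \<and> v \<in> verts (blowup J m)"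
    if "e \<in> edges (blowup J m)" for e
    using that unfolding blowup_def by auto
  ultimately show "graph (blowup J m)" unfolding graph_def by blast
  have td': "is_tree T" "\<And>x. x \<in> verts T \<Longrightarrow> B x \<subseteq> verts J \<and> card (B x) \<le> k + 1"
    "\<And>v. v \<in> verts J \<Longrightarrow> \<exists>x\<in>verts T. v \<in> B x"
    "\<And>u v. {u, v} \<in> edges J \<Longrightarrow> \<exists>x\<in>verts T. u \<in> B x \<and> v \<in> B x"
    "\<And>v. v \<in> verts J \<Longrightarrow> connected_in T {x\<in>verts T. v \<in> B x}"
    using td unfolding tree_decomp_width_le_def by blast+
  have "tree_decomp_width_le (blowup J m) T (\<lambda>x. {a. a div m \<in> B x}) ((k + 1) * m - 1)"
    unfolding tree_decomp_width_le_def
  proof (intro conjI ballI allI impI)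
    show "is_tree T" by (rule td')
  next
    fix x assume x: "x \<in> verts T"
    show "{a. a div m \<in> B x} \<subseteq> verts (blowup J m)" using td'(2)[OF x] by (auto simp: blowup_def)
    have "finite (B x)" using td'(2)[OF x] fJ finite_subset by blast
    then have "card {a. a div m \<in> B x} \<le> card (B x \<times> {..<m})"
      unfolding div_vimage_eq[OF m] by (intro card_image_le) simp
    also have "\<dots> \<le> (k + 1) * m" using td'(2)[OF x] unfolding card_cartesian_product card_lessThan
      by (intro mult_le_mono1) blast
    finally show "card {a. a div m \<in> B x} \<le> (k + 1) * m - 1 + 1" by linarith
  next
    fix v assume "v \<in> verts (blowup J m)"
    then have v: "v div m \<in> verts J" by (simp add: blowup_def)
    show "\<exists>x\<in>verts T. v \<in> {a. a div m \<in> B x}" using td'(3)[OF v] by simp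
    show "connected_in T {x \<in> verts T. v \<in> {a. a div m \<in> B x}}" using td'(5)[OF v] by simp
  next
    fix u v assume "{u, v} \<in> edges (blowup J m)"
    then show "\<exists>x\<in>verts T. u \<in> {a. a div m \<in> B x} \<and> v \<in> {a. a div m \<in> B x}"
      using td'(3)[of "u div m"] td'(4)[of "u div m" "v div m"] unfolding blowup_edge_iff by auto
  qed
  then show "treewidth (blowup J m) \<le> (k + 1) * m - 1" by (rule treewidth_le)
qed

text \<open>\<open>row_treewidth\<close> ranges over paths on the naturals, so P has to be replaced
  by such a copy.\<close>

lemma ex_nat_path:
  assumes "n \<ge> 1"
  obtains Q :: "nat graph" where "graph Q" "is_path Q" "verts Q = {0..<n}"
    "\<And>i. Suc i < n \<Longrightarrow> {i, Suc i} \<in> edges Q"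
proof -
  let ?Q = "({0..<n}, {{i, i + 1} | i. i + 1 < n})"
  have "graph ?Q" unfolding graph_def by fastforce
  moreover have "is_path ?Q"
    unfolding is_path_def
  proof (intro exI[of _ "[0..<n]"] conjI)
    have "e = {i, i + 1} \<and> i + 1 < n \<longleftrightarrow>
        e = {[0..<n] ! i, [0..<n] ! (i + 1)} \<and> i + 1 < length [0..<n]" for e i
      by auto
    then show "edges ?Q = {{[0..<n] ! i, [0..<n] ! (i + 1)} | i. i + 1 < length [0..<n]}"
      by (simp only: snd_conv)
  qed (use assms in auto)
  ultimately show ?thesis using that[of ?Q] by auto
qed

text \<open>The complete factor is moved past the path and merged into J, since a strong product
  does not depend on the order of its factors up to isomorphism.\<close>

lemma row_treewidth_le:
  fixes J :: "nat graph" and P :: "'p graph"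
  assumes m: "m \<ge> 1" and J: "graph J" and td: "tree_decomp_width_le J T B k" and P: "is_path P"
    and cont: "contained G (J \<boxtimes> P \<boxtimes> K m)"
  shows "row_treewidth G \<le> (k + 1) * m - 1"
proof -
  obtain xs ix where xs: "xs \<noteq> []" "\<And>i. i < length xs \<Longrightarrow> xs ! i \<in> verts P \<and> ix (xs ! i) = i"
    "\<And>p. p \<in> verts P \<Longrightarrow> ix p < length xs \<and> xs ! ix p = p"
    "\<And>p q. {p, q} \<in> edges P \<Longrightarrow> ix p = Suc (ix q) \<or> ix q = Suc (ix p)"
    by (rule is_path_index[OF P]) blast
  have "length xs \<ge> 1" using xs(1) by (simp add: Suc_le_eq)
  then obtain Q :: "nat graph" where Q: "graph Q" "is_path Q" and QV: "verts Q = {0..<length xs}"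
    and QE: "\<And>i. Suc i < length xs \<Longrightarrow> {i, Suc i} \<in> edges Q"
    by (rule ex_nat_path) blast
  obtain f where f: "inj_on f (verts G)" "f ` verts G \<subseteq> verts (J \<boxtimes> P \<boxtimes> K m)"
    and fE: "\<And>u v. {u, v} \<in> edges G \<Longrightarrow> {f u, f v} \<in> edges (J \<boxtimes> P \<boxtimes> K m)"
    using cont unfolding contained_def by blast
  define h where "h = (\<lambda>x :: (nat \<times> 'p) \<times> nat. (fst (fst x) * m + snd x, ix (snd (fst x))))"
  have h_verts: "h x \<in> verts (blowup J m \<boxtimes> Q)" if "x \<in> verts (J \<boxtimes> P \<boxtimes> K m)" for x
    using that xs(3) QV by (auto simp: h_def blowup_def)
  have h_inj: "inj_on h (verts (J \<boxtimes> P \<boxtimes> K m))"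
  proof (rule inj_onI)
    fix x y assume x: "x \<in> verts (J \<boxtimes> P \<boxtimes> K m)" and y: "y \<in> verts (J \<boxtimes> P \<boxtimes> K m)" and e: "h x = h y"
    have "snd x < m" "snd y < m" using x y by auto
    then have "fst (fst z) = fst (h z) div m \<and> snd z = fst (h z) mod m" if "z = x \<or> z = y" for z
      using that by (auto simp: h_def)
    then have "fst (fst x) = fst (fst y)" "snd x = snd y" using e by simp_all
    moreover have "snd (fst x) = snd (fst y)"
    proof -
      have "snd (fst x) \<in> verts P" "snd (fst y) \<in> verts P" using x y by auto
      moreover have "ix (snd (fst x)) = ix (snd (fst y))" using e by (simp add: h_def)
      ultimately show ?thesis using xs(3) by metis
    qed
    ultimately show "x = y" by (simp add: prod_eq_iff)
  qed
  have h_edge: "{h x, h y} \<in> edges (blowup J m \<boxtimes> Q)"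
    if xy: "x \<in> verts (J \<boxtimes> P \<boxtimes> K m)" "y \<in> verts (J \<boxtimes> P \<boxtimes> K m)" and e: "{x, y} \<in> edges (J \<boxtimes> P \<boxtimes> K m)" for x y
  proof -
    obtain a p i b q j where eq: "x = ((a, p), i)" "y = ((b, q), j)" by (metis prod.exhaust)
    have v: "a \<in> verts J" "b \<in> verts J" "p \<in> verts P" "q \<in> verts P" "i < m" "j < m"
      using xy by (auto simp: eq)
    from e have ne: "x \<noteq> y" and "(a, p) = (b, q) \<or> {(a, p), (b, q)} \<in> edges (J \<boxtimes> P)"
      unfolding eq strong_prod_edge_iff by blast+
    then have ab: "a = b \<or> {a, b} \<in> edges J" and pq: "p = q \<or> {p, q} \<in> edges P"
      unfolding strong_prod_edge_iff by blast+
    have "h x \<noteq> h y" using h_inj xy ne by (auto dest: inj_onD)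
    moreover have "ix p = ix q \<or> {ix p, ix q} \<in> edges Q"
      using pq xs(4)[of p q] QE[of "ix p"] QE[of "ix q"] xs(3)[OF v(3)] xs(3)[OF v(4)]
      by (auto simp: insert_commute)
    moreover have "a * m + i = b * m + j \<or> {a * m + i, b * m + j} \<in> edges (blowup J m)"
      using v ab by (simp add: blowup_edge_iff)
    ultimately show ?thesis
      using h_verts[OF xy(1)] h_verts[OF xy(2)] unfolding eq h_def by (simp add: strong_prod_edge_iff)
  qed
  have "contained G (blowup J m \<boxtimes> Q)"
    unfolding contained_def
  proof (intro exI[of _ "h \<circ> f"] conjI allI impI)
    show "inj_on (h \<circ> f) (verts G)" using f h_inj by (meson comp_inj_on inj_on_subset)
    show "(h \<circ> f) ` verts G \<subseteq> verts (blowup J m \<boxtimes> Q)" using f(2) h_verts by fastforce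
    fix u v assume "{u, v} \<in> edges G"
    then have e: "{f u, f v} \<in> edges (J \<boxtimes> P \<boxtimes> K m)" by (rule fE)
    then have "f u \<in> verts (J \<boxtimes> P \<boxtimes> K m)" "f v \<in> verts (J \<boxtimes> P \<boxtimes> K m)"
      by (metis prod.exhaust_sel strong_prod_edge_iff strong_prod_verts SigmaI)+
    then show "{(h \<circ> f) u, (h \<circ> f) v} \<in> edges (blowup J m \<boxtimes> Q)" using h_edge e by simp
  qed
  then have "row_treewidth G \<le> treewidth (blowup J m)"
    unfolding row_treewidth_def using blowup_treewidth(1)[OF m J td] Q by (intro Least_le) blast
  then show ?thesis using blowup_treewidth(2)[OF m J td] by linarith
qed

theorem theorem11:
  fixes r t l :: nat
    and G :: "'g graph" and H :: "'h graph" and P :: "'p graph"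
  assumes "l \<ge> 1"
    and "graph G" and "graph H" and "graph P"
    and "treewidth H \<le> t"
    and "is_path P"
    and "shallow_minor r G (H \<boxtimes> P \<boxtimes> K l)"
  shows "(\<exists>J :: nat graph. graph J \<and> treewidth J \<le> ((2*r+1+t) choose t) - 1 \<and>
            contained G (J \<boxtimes> P \<boxtimes> K (l * (2*r+1)^2)))
       \<and> row_treewidth G \<le> ((2*r+1+t) choose t) * l * (2*r+1)^2 - 1"
proof -
  let ?c = "(2*r+1+t) choose t"
  obtain T B where "tree_decomp_width_le H T B (treewidth H)"
    by (rule tree_decomp_treewidth[OF assms(3)])
  then have "tree_decomp_width_le H T B t" using assms(5) by (rule tree_decomp_mono)
  from elim_order_of_tree_decomp[OF assms(3) this]
  obtain \<phi> N where \<phi>: "bij_betw \<phi> (verts H) {1..card (verts H)}"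
    and N: "elim_order N" "\<And>i. card (N i) \<le> t" "\<And>i. N i \<subseteq> {1..}"
    and HN: "\<And>u v. {u, v} \<in> edges H \<Longrightarrow> \<phi> u \<in> N (\<phi> v) \<or> \<phi> v \<in> N (\<phi> u)"
    by blast
  define J where "J = reach_graph (card (verts H)) N (2*r+1)"
  have J: "graph J" and "\<exists>T B. tree_decomp_width_le J T B (?c - 1)"
    using reach_graph_tree_decomp[OF N] unfolding J_def by blast+
  then obtain T' B' where td: "tree_decomp_width_le J T' B' (?c - 1)" by blast
  have cont: "contained G (J \<boxtimes> P \<boxtimes> K (l * (2*r+1)^2))"
    unfolding J_def by (rule shallow_minor_contained[OF assms(2,6) \<phi> N(1) HN assms(7)])
  have m: "l * (2*r+1)^2 \<ge> 1" using assms(1) by simp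
  \<comment> \<open>Positivity makes the truncated subtraction in the width cancel against the added
    one.\<close>
  have "?c \<ge> 1" using zero_less_binomial[of t "2*r+1+t"] by linarith
  then have "(?c - 1 + 1) * (l * (2*r+1)^2) = ?c * l * (2*r+1)^2" by (simp only: le_add_diff_inverse2 mult.assoc)
  then have "row_treewidth G \<le> ?c * l * (2*r+1)^2 - 1"
    using row_treewidth_le[OF m J td assms(6) cont] by metis
  then show ?thesis using J cont treewidth_le[OF td] by blast
qed

end
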